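(* Let $1\le p\le\infty$ and let $A,B:L_p(\mathbb{R},\mu)\to L_p(\mathbb{R},\mu)$ be the operators defined, for almost every $t$, by $$(Ax)(t)=\int_{\alpha_1}^{\beta_1}I_{[\alpha,\beta]}(t)\Big(\theta_{A,1}\sin(\omega t)\cos(\omega s)+\frac{1}{\delta\sigma_2}\cos(\omega t)\cos(\omega s)+\frac{1}{\delta\sigma_1}\sin(\omega t)\sin(\omega s)\Big)x(s)\,d\mu_s,$$ $$(Bx)(t)=\int_{\alpha_1}^{\beta_1}I_{[\alpha,\beta]}(t)\Big(\theta_{B,1}\sin(\omega t)\cos(\omega s)+\frac{2\sigma_1}{\sigma_2}\theta_{B,3}\cos(\omega t)\cos(\omega s)+\theta_{B,3}\sin(\omega t)\sin(\omega s)\Big)x(s)\,d\mu_s,$$ where $\theta_{A,1},\theta_{B,1},\theta_{B,3},\omega\in\mathbb{R}$, $\delta\in\mathbb{R}\setminus\{0\}$, $\alpha,\beta,\alpha_1,\beta_1\in\mathbb{R}$, $\alpha_1<\beta_1$, $\alpha\le\alpha_1$, $\beta\ge\beta_1$, either $\frac{\omega}{\pi}(\beta_1-\alpha_1)\in\mathbb{Z}$ or $\frac{\omega}{\pi}(\beta_1+\alpha_1)\in\mathbb{Z}$, and $\sigma_1\ne0$, $\sigma_2\neq0$. Let $\{\theta_n\}$ and $\{\varsigma_n\}$ be sequences of real numbers and let $A_n,B_n:L_p(\mathbb{R},\mu)\to L_p(\mathbb{R},\mu)$ be defined, for almost every $t$, by $$(A_nx)(t)=\int_{\alpha_1}^{\beta_1}I_{[\alpha,\beta]}(t)\Big(\theta_n\sin(\omega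 t)\cos(\omega s)+\frac{1}{\delta\sigma_2}\cos(\omega t)\cos(\omega s)+\frac{1}{\delta\sigma_1}\sin(\omega t)\sin(\omega s)\Big)x(s)\,d\mu_s,$$ $$(B_nx)(t)=\int_{\alpha_1}^{\beta_1}I_{[\alpha,\beta]}(t)\Big(\theta_{B,1}\sin(\omega t)\cos(\omega s)+\frac{2\sigma_1}{\sigma_2}\varsigma_n\cos(\omega t)\cos(\omega s)+\varsigma_n\sin(\omega t)\sin(\omega s)\Big)x(s)\,d\mu_s.$$ Then: 1. $AB=\delta BA^2$, $A_nB=\delta BA_n^2$, $A_nB_n=\delta B_nA_n^2$ and $AB_n=\delta B_nA^2$ for each positive integer $n$. Moreover, for all $x\in L_p(\mathbb{R},\mu)$ and almost every $t$, $$(AB-BA)x(t)=\theta_{A,1}\sigma_1\theta_{B,3}\int_{\alpha_1}^{\beta_1}I_{[\alpha,\beta]}(t)\sin(\omega t)\cos(\omega s)x(s)\,d\mu_s.$$ 2. If $\theta_n\to0$ as $n\to\infty$, then $A_n\to\tilde A$ in norm, where, for almost every $t$, $$(\tilde Ax)(t)=\int_{\alpha_1}^{\beta_1}I_{[\alpha,\beta]}(t)\Big(\frac{1}{\delta\sigma_2}\cos(\omega t)\cos(\omega s)+\frac{1}{\delta\sigma_1}\sin(\omega t)\sin(\omega s)\Big)x(s)\,d\mu_s,$$ so $A_nB-BA_n\to0$ in norm and $\tilde AB=B\tilde A$. 3. If $\varsigma_n\to0$ as $n\to\infty$, then $B_n\to\tilde B$ in norm, where $(\tilde Bx)(t)=\int_{\alpha_1}^{\beta_1}I_{[\alpha,\beta]}(t)\theta_{B,1}\sin(\omega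 t)\cos(\omega s)x(s)\,d\mu_s$ for almost every $t$. Moreover, $AB_n-B_nA\to0$ in norm and $A\tilde B=\tilde BA$. 4. If $\theta_n\to0$ and $\varsigma_n\to0$ as $n\to\infty$, then $A_nB_n-B_nA_n\to0$ in norm and $\tilde A$ commutes with $\tilde B$ (with $\tilde A$, $\tilde B$ the operators given in items 2 and 3). 5. Let $\lambda_0\in\mathrm{cl}(\Lambda)$. If $\theta_{A,1}\sigma_1\theta_{B,3}\tilde\lambda\to0$ when $(\theta_{A,1},\theta_{B,1},\theta_{B,3},\alpha_1,\beta_1,\alpha,\beta,\sigma_1,\sigma_2,\delta,\omega)\to\lambda_0$ within $\Lambda$, then for all $x\in L_p(\mathbb{R},\mu)$ it holds that $\|(AB-BA)x\|_{L_p}\to0$ (along the same limit of parameters, $A$ and $B$ being the operators with these parameters).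
   Context: $\mu$ is Lebesgue measure on $\mathbb{R}$; $L_p(\mathbb{R},\mu)$ is the real Lebesgue space; the index in $d\mu_s$ indicates the variable of integration; $I_E$ is the indicator function of the set $E$; convergence in norm means convergence in the operator norm on $L_p(\mathbb{R},\mu)$. The constants are $$\sigma_1=\int_{\alpha_1}^{\beta_1}(\sin(\omega s))^2d\mu_s,\qquad \sigma_2=\int_{\alpha_1}^{\beta_1}(\cos(\omega s))^2d\mu_s=\beta_1-\alpha_1-\sigma_1.$$ The parameter set is $$\Lambda=\Big\{(\theta_{A,1},\theta_{B,1},\theta_{B,3},\alpha_1,\beta_1,\alpha,\beta,\sigma_1,\sigma_2,\delta,\omega)\in\mathbb{R}^{11}:\ \delta\ne0,\ \alpha_1<\beta_1,\ \alpha\le\alpha_1,\ \beta\ge\beta_1,\ \int_{\alpha_1}^{\beta_1}\sin(\omega s)\cos(\omega s)d\mu_s=0,\ \sigma_1=\int_{\alpha_1}^{\beta_1}(\sin(\omega s))^2d\mu_s\ne0,\ \sigma_2=\beta_1-\alpha_1-\sigma_1\ne0\Big\},$$ and $\mathrm{cl}(\Lambda)$ is its closure in $\mathbb{R}^{11}$. Further, $\tilde\lambda=|\beta-\alpha|^{1/p}|\beta_1-\alpha_1|^{1/q}$ with $\frac1p+\frac1q=1$ if $1<p<\infty$, $\tilde\lambda=|\beta_1-\alpha_1|$ if $p=\infty$, and $\tilde\lambda=|\beta-\alpha|$ if $p=1$. *)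

theory Defs
  imports "HOL-Analysis.Analysis" "HOL-Probability.Essential_Supremum"
begin

section \<open>The spaces \<open>L_p\<close> over the real line\<close>

definition ae_eq :: "(real \<Rightarrow> real) \<Rightarrow> (real \<Rightarrow> real) \<Rightarrow> bool" where
  "ae_eq f g \<longleftrightarrow> f \<in> borel_measurable lebesgue \<and> g \<in> borel_measurable lebesgue
     \<and> (AE t in lebesgue. f t = g t)"

lemma part_equivp_ae_eq: "part_equivp ae_eq"
proof (rule part_equivpI)
  show "\<exists>x. ae_eq x x"
    by (rule exI[of _ "\<lambda>_. 0"]) (simp add: ae_eq_def)
  show "symp ae_eq"
    by (rule sympI) (auto simp: ae_eq_def eq_commute)
  show "transp ae_eq"
  proof (rule transpI)
    fix f g h assume "ae_eq f g" "ae_eq g h"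
    then show "ae_eq f h"
      unfolding ae_eq_def by (auto elim: eventually_elim2)
  qed
qed

text \<open>Classes of Lebesgue measurable functions modulo equality almost everywhere.  All spaces
  \<open>L_p\<close> are subspaces of this vector space.\<close>

quotient_type L0 = "real \<Rightarrow> real" / partial: ae_eq
  by (rule part_equivp_ae_eq)

instantiation L0 :: real_vector
begin

lift_definition zero_L0 :: L0 is "\<lambda>_. 0"
  by (simp add: ae_eq_def)

lift_definition plus_L0 :: "L0 \<Rightarrow> L0 \<Rightarrow> L0" is "\<lambda>f g t. f t + g t"
  by (auto simp: ae_eq_def elim: eventually_elim2)

lift_definition minus_L0 :: "L0 \<Rightarrow> L0 \<Rightarrow> L0" is "\<lambda>f g t. f t - g t"
  by (auto simp: ae_eq_def elim: eventually_elim2)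

lift_definition uminus_L0 :: "L0 \<Rightarrow> L0" is "\<lambda>f t. - f t"
  by (auto simp: ae_eq_def)

lift_definition scaleR_L0 :: "real \<Rightarrow> L0 \<Rightarrow> L0" is "\<lambda>r f t. r * f t"
  by (auto simp: ae_eq_def)

instance
  by (standard; transfer) (auto simp: ae_eq_def algebra_simps)

end

text \<open>Values of an element are meaningful only almost everywhere: \<open>rep_L0\<close> picks some
  representative.\<close>

lemma rep_L0_measurable [measurable]: "rep_L0 x \<in> borel_measurable lebesgue"
  using Quotient3_rep_reflp[OF Quotient3_L0, of x] by (simp add: ae_eq_def)

lemma rep_abs_L0:
  assumes "f \<in> borel_measurable lebesgue"
  shows "AE t in lebesgue. rep_L0 (abs_L0 f) t = f t"
  using rep_abs_rsp_left[OF Quotient3_L0, of f f] assms by (simp add: ae_eq_def)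

definition Lp_norm :: "ennreal \<Rightarrow> L0 \<Rightarrow> ennreal" where
  "Lp_norm p x =
    (if p = \<infinity> then esssup lebesgue (\<lambda>t. ennreal \<bar>rep_L0 x t\<bar>)
     else let I = \<integral>\<^sup>+ t. ennreal (\<bar>rep_L0 x t\<bar> powr enn2real p) \<partial>lebesgue
          in if I = \<infinity> then \<infinity> else ennreal (enn2real I powr (1 / enn2real p)))"

definition Lp :: "ennreal \<Rightarrow> L0 set" where
  "Lp p = {x. Lp_norm p x < \<infinity>}"

text \<open>Operator norm on \<open>Lp p\<close>; its value is \<open>\<infinity>\<close> for unbounded operators, and for maps that
  do not send the unit ball of \<open>Lp p\<close> into \<open>Lp p\<close>.\<close>

definition op_norm :: "ennreal \<Rightarrow> (L0 \<Rightarrow> L0) \<Rightarrow> ennreal" where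
  "op_norm p T = (SUP x\<in>{x. Lp_norm p x \<le> 1}. Lp_norm p (T x))"

definition conv_in_norm :: "ennreal \<Rightarrow> (nat \<Rightarrow> L0 \<Rightarrow> L0) \<Rightarrow> (L0 \<Rightarrow> L0) \<Rightarrow> bool" where
  "conv_in_norm p T S \<longleftrightarrow> (\<lambda>n. op_norm p (\<lambda>x. T n x - S x)) \<longlonglongrightarrow> 0"

section \<open>The integral operators\<close>

text \<open>Applied to elements of \<open>Lp p\<close>, the kernels below give measurable integrals; see
  \<open>integral_op_trig\<close>.\<close>

definition integral_op ::
  "(real \<Rightarrow> real \<Rightarrow> real) \<Rightarrow> real \<Rightarrow> real \<Rightarrow> real \<Rightarrow> real \<Rightarrow> L0 \<Rightarrow> L0" where
  "integral_op K \<alpha>\<^sub>1 \<beta>\<^sub>1 \<alpha> \<beta> x =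
     abs_L0 (\<lambda>t. LINT s:{\<alpha>\<^sub>1..\<beta>\<^sub>1}|lebesgue. indicator {\<alpha>..\<beta>} t * K t s * rep_L0 x s)"

definition op_A ::
  "real \<Rightarrow> real \<Rightarrow> real \<Rightarrow> real \<Rightarrow> real \<Rightarrow> real \<Rightarrow> real \<Rightarrow> real \<Rightarrow> real \<Rightarrow> L0 \<Rightarrow> L0" where
  "op_A \<theta>\<^sub>A\<^sub>1 \<alpha>\<^sub>1 \<beta>\<^sub>1 \<alpha> \<beta> \<sigma>\<^sub>1 \<sigma>\<^sub>2 \<delta> \<omega> =
     integral_op (\<lambda>t s. \<theta>\<^sub>A\<^sub>1 * sin (\<omega> * t) * cos (\<omega> * s)
                      + 1 / (\<delta> * \<sigma>\<^sub>2) * cos (\<omega> * t) * cos (\<omega> * s)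
                      + 1 / (\<delta> * \<sigma>\<^sub>1) * sin (\<omega> * t) * sin (\<omega> * s)) \<alpha>\<^sub>1 \<beta>\<^sub>1 \<alpha> \<beta>"

definition op_B ::
  "real \<Rightarrow> real \<Rightarrow> real \<Rightarrow> real \<Rightarrow> real \<Rightarrow> real \<Rightarrow> real \<Rightarrow> real \<Rightarrow> real \<Rightarrow> L0 \<Rightarrow> L0" where
  "op_B \<theta>\<^sub>B\<^sub>1 \<theta>\<^sub>B\<^sub>3 \<alpha>\<^sub>1 \<beta>\<^sub>1 \<alpha> \<beta> \<sigma>\<^sub>1 \<sigma>\<^sub>2 \<omega> =
     integral_op (\<lambda>t s. \<theta>\<^sub>B\<^sub>1 * sin (\<omega> * t) * cos (\<omega> * s)
                      + 2 * \<sigma>\<^sub>1 / \<sigma>\<^sub>2 * \<theta>\<^sub>B\<^sub>3 * cos (\<omega> * t) * cos (\<omega> * s)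
                      + \<theta>\<^sub>B\<^sub>3 * sin (\<omega> * t) * sin (\<omega> * s)) \<alpha>\<^sub>1 \<beta>\<^sub>1 \<alpha> \<beta>"

type_synonym params =
  "real \<times> real \<times> real \<times> real \<times> real \<times> real \<times> real \<times> real \<times> real \<times> real \<times> real"

definition Lambda :: "params set" where
  "Lambda = {(\<theta>\<^sub>A\<^sub>1, \<theta>\<^sub>B\<^sub>1, \<theta>\<^sub>B\<^sub>3, \<alpha>\<^sub>1, \<beta>\<^sub>1, \<alpha>, \<beta>, \<sigma>\<^sub>1, \<sigma>\<^sub>2, \<delta>, \<omega>).
     \<delta> \<noteq> 0 \<and> \<alpha>\<^sub>1 < \<beta>\<^sub>1 \<and> \<alpha> \<le> \<alpha>\<^sub>1 \<and> \<beta> \<ge> \<beta>\<^sub>1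
     \<and> (LINT s:{\<alpha>\<^sub>1..\<beta>\<^sub>1}|lebesgue. sin (\<omega> * s) * cos (\<omega> * s)) = 0
     \<and> \<sigma>\<^sub>1 = (LINT s:{\<alpha>\<^sub>1..\<beta>\<^sub>1}|lebesgue. (sin (\<omega> * s))\<^sup>2) \<and> \<sigma>\<^sub>1 \<noteq> 0
     \<and> \<sigma>\<^sub>2 = \<beta>\<^sub>1 - \<alpha>\<^sub>1 - \<sigma>\<^sub>1 \<and> \<sigma>\<^sub>2 \<noteq> 0}"

text \<open>In the last case the second exponent is \<open>1/q\<close> for the exponent \<open>q\<close> conjugate to \<open>p\<close>.\<close>

definition lambda_tilde :: "ennreal \<Rightarrow> real \<Rightarrow> real \<Rightarrow> real \<Rightarrow> real \<Rightarrow> real" where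
  "lambda_tilde p \<alpha>\<^sub>1 \<beta>\<^sub>1 \<alpha> \<beta> =
     (if p = \<infinity> then \<bar>\<beta>\<^sub>1 - \<alpha>\<^sub>1\<bar>
      else if p = 1 then \<bar>\<beta> - \<alpha>\<bar>
      else \<bar>\<beta> - \<alpha>\<bar> powr (1 / enn2real p) * \<bar>\<beta>\<^sub>1 - \<alpha>\<^sub>1\<bar> powr (1 - 1 / enn2real p))"

section \<open>The operators act on \<open>Lp p\<close> as intended\<close>

lemma Lp_imp_set_integrable:
  assumes p: "1 \<le> p" and x: "x \<in> Lp p"
  shows "set_integrable lebesgue {a..b} (rep_L0 x)"
proof -
  have *: "(\<integral>\<^sup>+ t. ennreal (norm (indicator {a..b} t *\<^sub>R rep_L0 x t)) \<partial>lebesgue) < \<infinity>"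
  proof (cases "p = \<infinity>")
    case True
    define C where "C = esssup lebesgue (\<lambda>t. ennreal \<bar>rep_L0 x t\<bar>)"
    have C: "C < \<infinity>" using x True by (simp add: Lp_def Lp_norm_def C_def)
    have "AE t in lebesgue. ennreal \<bar>rep_L0 x t\<bar> \<le> C"
      unfolding C_def by (rule esssup_AE)
    then have "(\<integral>\<^sup>+ t. ennreal (norm (indicator {a..b} t *\<^sub>R rep_L0 x t)) \<partial>lebesgue)
        \<le> (\<integral>\<^sup>+ t. C * indicator {a..b} t \<partial>lebesgue)"
      by (intro nn_integral_mono_AE) (auto simp: indicator_def elim: eventually_mono)
    also have "\<dots> = C * emeasure lebesgue {a..b}"
      by (rule nn_integral_cmult_indicator) auto
    also have "\<dots> < \<infinity>"
      using C by (auto simp: ennreal_mult_less_top emeasure_lborel_Icc_eq)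
    finally show ?thesis .
  next
    case False
    define r where "r = enn2real p"
    have r: "1 \<le> r"
      using p False unfolding r_def
      by (metis enn2real_1 enn2real_mono infinity_ennreal_def top.not_eq_extremum)
    define I where "I = (\<integral>\<^sup>+ t. ennreal (\<bar>rep_L0 x t\<bar> powr r) \<partial>lebesgue)"
    have I: "I < \<infinity>"
      using x False by (auto simp: Lp_def Lp_norm_def Let_def I_def r_def top.not_eq_extremum
          split: if_splits)
    have le: "\<bar>y\<bar> \<le> 1 + \<bar>y\<bar> powr r" for y :: real
    proof (cases "\<bar>y\<bar> \<le> 1")
      case True then show ?thesis using powr_ge_zero[of "\<bar>y\<bar>" r] by linarith
    next
      case False
      then have "\<bar>y\<bar> powr 1 \<le> \<bar>y\<bar> powr r" using r by (intro powr_mono) auto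
      then show ?thesis using False by simp
    qed
    have "(\<integral>\<^sup>+ t. ennreal (norm (indicator {a..b} t *\<^sub>R rep_L0 x t)) \<partial>lebesgue)
        \<le> (\<integral>\<^sup>+ t. indicator {a..b} t + ennreal (\<bar>rep_L0 x t\<bar> powr r) \<partial>lebesgue)"
    proof (rule nn_integral_mono)
      fix t
      show "ennreal (norm (indicator {a..b} t *\<^sub>R rep_L0 x t))
          \<le> indicator {a..b} t + ennreal (\<bar>rep_L0 x t\<bar> powr r)"
        using ennreal_leI[OF le[of "rep_L0 x t"]] by (simp add: indicator_def)
    qed
    also have "\<dots> = emeasure lebesgue {a..b} + I"
      unfolding I_def by (subst nn_integral_add) (auto intro!: borel_measurable_indicator)
    also have "\<dots> < \<infinity>"
      using I by (auto simp: emeasure_lborel_Icc_eq)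
    finally show ?thesis .
  qed
  have "(\<lambda>t. indicator {a..b} t *\<^sub>R rep_L0 x t) \<in> borel_measurable lebesgue"
    by (intro borel_measurable_scaleR borel_measurable_indicator rep_L0_measurable) auto
  then show ?thesis
    unfolding set_integrable_def using * by (rule integrableI_bounded)
qed

lemma abs_L0_in_Lp:
  assumes p: "1 \<le> p" and f [measurable]: "f \<in> borel_measurable lebesgue"
    and bound: "\<And>t. \<bar>f t\<bar> \<le> M * indicator {a..b} t"
  shows "abs_L0 f \<in> Lp p"
proof -
  have M: "\<bar>f t\<bar> \<le> \<bar>M\<bar>" for t
    using bound[of t] by (cases "t \<in> {a..b}") auto
  note ae = rep_abs_L0[OF f]
  show ?thesis
  proof (cases "p = \<infinity>")
    case True
    have "esssup lebesgue (\<lambda>t. ennreal \<bar>rep_L0 (abs_L0 f) t\<bar>) \<le> ennreal \<bar>M\<bar>"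
      by (rule esssup_I) (use ae M in \<open>auto elim!: eventually_mono\<close>)
    then show ?thesis
      using True by (auto simp: Lp_def Lp_norm_def intro: le_less_trans)
  next
    case False
    define r where "r = enn2real p"
    have r: "1 \<le> r"
      using p False unfolding r_def
      by (metis enn2real_1 enn2real_mono infinity_ennreal_def top.not_eq_extremum)
    have "(\<integral>\<^sup>+ t. ennreal (\<bar>rep_L0 (abs_L0 f) t\<bar> powr r) \<partial>lebesgue)
        \<le> (\<integral>\<^sup>+ t. ennreal (\<bar>M\<bar> powr r) * indicator {a..b} t \<partial>lebesgue)"
    proof (rule nn_integral_mono_AE, use ae in eventually_elim)
      fix t assume t: "rep_L0 (abs_L0 f) t = f t"
      show "ennreal (\<bar>rep_L0 (abs_L0 f) t\<bar> powr r) \<le> ennreal (\<bar>M\<bar> powr r) * indicator {a..b} t"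
      proof (cases "t \<in> {a..b}")
        case True
        then show ?thesis using t M[of t] r by (auto intro!: ennreal_leI powr_mono2)
      next
        case False
        then show ?thesis using t bound[of t] by auto
      qed
    qed
    also have "\<dots> = ennreal (\<bar>M\<bar> powr r) * emeasure lebesgue {a..b}"
      by (rule nn_integral_cmult_indicator) auto
    also have "\<dots> < \<infinity>"
      by (auto simp: ennreal_mult_less_top emeasure_lborel_Icc_eq)
    finally show ?thesis
      using False by (auto simp: Lp_def Lp_norm_def r_def Let_def)
  qed
qed

lemma set_integrable_mult_bounded:
  assumes "set_integrable lebesgue {a..b} f" and g: "g \<in> borel_measurable borel"
    and "\<And>s::real. \<bar>g s\<bar> \<le> (1::real)"
  shows "set_integrable lebesgue {a..b} (\<lambda>s. g s * f s :: real)"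
proof -
  have g' [measurable]: "g \<in> borel_measurable lebesgue"
    using g by (simp add: measurable_completion)
  have [measurable]: "(\<lambda>s. indicator {a..b} s *\<^sub>R f s) \<in> borel_measurable lebesgue"
    using assms(1) unfolding set_integrable_def by (rule borel_measurable_integrable)
  have eq: "(\<lambda>s. indicator {a..b} s *\<^sub>R (g s * f s)) = (\<lambda>s. g s * (indicator {a..b} s *\<^sub>R f s))"
    by auto
  have "(\<lambda>s. g s * (indicator {a..b} s *\<^sub>R f s)) \<in> borel_measurable lebesgue"
    by measurable
  then show ?thesis
    unfolding set_integrable_def eq
    by (intro Bochner_Integration.integrable_bound[OF assms(1)[unfolded set_integrable_def]])
      (auto simp: abs_mult intro!: mult_left_le_one_le assms(3))
qed

lemma integral_op_trig:
  fixes a b c \<omega> \<alpha>\<^sub>1 \<beta>\<^sub>1 \<alpha> \<beta> :: real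
  assumes p: "1 \<le> p" and x: "x \<in> Lp p"
  defines "K \<equiv> \<lambda>t s. a * sin (\<omega> * t) * cos (\<omega> * s) + b * cos (\<omega> * t) * cos (\<omega> * s)
                  + c * sin (\<omega> * t) * sin (\<omega> * s)"
  shows "integral_op K \<alpha>\<^sub>1 \<beta>\<^sub>1 \<alpha> \<beta> x \<in> Lp p"
    and "AE t in lebesgue. rep_L0 (integral_op K \<alpha>\<^sub>1 \<beta>\<^sub>1 \<alpha> \<beta> x) t
           = (LINT s:{\<alpha>\<^sub>1..\<beta>\<^sub>1}|lebesgue. indicator {\<alpha>..\<beta>} t * K t s * rep_L0 x s)"
proof -
  define C where "C = (LINT s:{\<alpha>\<^sub>1..\<beta>\<^sub>1}|lebesgue. cos (\<omega> * s) * rep_L0 x s)"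
  define S where "S = (LINT s:{\<alpha>\<^sub>1..\<beta>\<^sub>1}|lebesgue. sin (\<omega> * s) * rep_L0 x s)"
  define f where "f = (\<lambda>t. LINT s:{\<alpha>\<^sub>1..\<beta>\<^sub>1}|lebesgue. indicator {\<alpha>..\<beta>} t * K t s * rep_L0 x s)"
  have int: "set_integrable lebesgue {\<alpha>\<^sub>1..\<beta>\<^sub>1} (\<lambda>s. cos (\<omega> * s) * rep_L0 x s)"
    "set_integrable lebesgue {\<alpha>\<^sub>1..\<beta>\<^sub>1} (\<lambda>s. sin (\<omega> * s) * rep_L0 x s)"
    by (intro set_integrable_mult_bounded Lp_imp_set_integrable[OF p x]; simp)+
  have f_eq: "f t = indicator {\<alpha>..\<beta>} t *
      ((a * sin (\<omega> * t) + b * cos (\<omega> * t)) * C + c * sin (\<omega> * t) * S)" for t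
  proof -
    have "f t = (LINT s:{\<alpha>\<^sub>1..\<beta>\<^sub>1}|lebesgue.
        (indicator {\<alpha>..\<beta>} t * (a * sin (\<omega> * t) + b * cos (\<omega> * t))) * (cos (\<omega> * s) * rep_L0 x s)
        + (indicator {\<alpha>..\<beta>} t * (c * sin (\<omega> * t))) * (sin (\<omega> * s) * rep_L0 x s))"
      unfolding f_def K_def
      by (intro set_lebesgue_integral_cong) (auto simp: algebra_simps)
    also have "\<dots> = (indicator {\<alpha>..\<beta>} t * (a * sin (\<omega> * t) + b * cos (\<omega> * t))) * C
        + (indicator {\<alpha>..\<beta>} t * (c * sin (\<omega> * t))) * S"
      unfolding C_def S_def
      by (subst set_integral_add) (use int in auto)
    finally show ?thesis by (simp add: algebra_simps)
  qed
  have "f \<in> borel_measurable borel"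
    unfolding f_eq[abs_def] by measurable
  then have meas: "f \<in> borel_measurable lebesgue"
    by (simp add: measurable_completion)
  have bound: "\<bar>f t\<bar> \<le> ((\<bar>a\<bar> + \<bar>b\<bar>) * \<bar>C\<bar> + \<bar>c\<bar> * \<bar>S\<bar>) * indicator {\<alpha>..\<beta>} t" for t
  proof -
    have "\<bar>(a * sin (\<omega> * t) + b * cos (\<omega> * t)) * C + c * sin (\<omega> * t) * S\<bar>
        \<le> \<bar>a * sin (\<omega> * t) + b * cos (\<omega> * t)\<bar> * \<bar>C\<bar> + \<bar>c * sin (\<omega> * t)\<bar> * \<bar>S\<bar>"
      by (metis abs_mult abs_triangle_ineq)
    also have "\<dots> \<le> (\<bar>a\<bar> + \<bar>b\<bar>) * \<bar>C\<bar> + \<bar>c\<bar> * \<bar>S\<bar>"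
    proof (intro add_mono mult_right_mono)
      have "\<bar>a * sin (\<omega> * t)\<bar> \<le> \<bar>a\<bar>" "\<bar>b * cos (\<omega> * t)\<bar> \<le> \<bar>b\<bar>"
        by (simp_all add: abs_mult mult_left_le)
      then show "\<bar>a * sin (\<omega> * t) + b * cos (\<omega> * t)\<bar> \<le> \<bar>a\<bar> + \<bar>b\<bar>" by linarith
      show "\<bar>c * sin (\<omega> * t)\<bar> \<le> \<bar>c\<bar>" by (simp add: abs_mult mult_left_le)
    qed auto
    finally show ?thesis
      unfolding f_eq by (auto simp: indicator_def)
  qed
  have op: "integral_op K \<alpha>\<^sub>1 \<beta>\<^sub>1 \<alpha> \<beta> x = abs_L0 f"
    by (simp add: integral_op_def f_def)
  show "integral_op K \<alpha>\<^sub>1 \<beta>\<^sub>1 \<alpha> \<beta> x \<in> Lp p"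
    unfolding op by (rule abs_L0_in_Lp[OF p meas bound])
  show "AE t in lebesgue. rep_L0 (integral_op K \<alpha>\<^sub>1 \<beta>\<^sub>1 \<alpha> \<beta> x) t
           = (LINT s:{\<alpha>\<^sub>1..\<beta>\<^sub>1}|lebesgue. indicator {\<alpha>..\<beta>} t * K t s * rep_L0 x s)"
    unfolding op using rep_abs_L0[OF meas] by (simp add: f_def)
qed

end

theory Submission
  imports Defs
begin

text \<open>Every operator in the theorem has a kernel in the span of
  \<open>sin (\<omega>t) cos (\<omega>s)\<close>, \<open>cos (\<omega>t) cos (\<omega>s)\<close> and \<open>sin (\<omega>t) sin (\<omega>s)\<close>. Call it
  \<open>T(a, b, c)\<close> after its coefficients. Write \<open>C x\<close> and \<open>S x\<close> for the integrals of
  \<open>cos (\<omega>s) x(s)\<close> and \<open>sin (\<omega>s) x(s)\<close> over \<open>[\<alpha>\<^sub>1, \<beta>\<^sub>1]\<close>, and \<open>e\<^sub>s\<close>, \<open>e\<^sub>c\<close> for sine and cosine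
  cut off outside \<open>[\<alpha>, \<beta>]\<close>. Then \<open>T(a, b, c) x = (a C x + c S x) e\<^sub>s + (b C x) e\<^sub>c\<close>, so that the
  whole theorem is about operators of rank at most two (\<open>trig_op_eq\<close>).

  The condition on \<open>\<omega>\<close> says that sine and cosine are orthogonal on \<open>[\<alpha>\<^sub>1, \<beta>\<^sub>1]\<close>. Hence
  \<open>T(a, b, c)\<close> acts on the plane spanned by \<open>e\<^sub>s\<close>, \<open>e\<^sub>c\<close> by the upper triangular matrix with diagonal
  \<open>\<sigma>\<^sub>1 c\<close>, \<open>\<sigma>\<^sub>2 b\<close> and corner \<open>\<sigma>\<^sub>2 a\<close>, and products of operators correspond to products of matrices
  (\<open>trig_op_compose\<close>). The matrix of \<open>\<delta>A\<close> is unipotent with corner \<open>h = \<delta> \<sigma>\<^sub>2 \<theta>\<^sub>A\<^sub>1\<close>; its square has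
  corner \<open>2h\<close>. The diagonal of \<open>B\<close> is \<open>\<sigma>\<^sub>1 \<theta>\<^sub>B\<^sub>3\<close> times \<open>(1, 2)\<close>, and moving \<open>\<delta>A\<close> across such a
  matrix doubles the corner: \<open>(\<delta>A) B = B (\<delta>A)\<^sup>2\<close>, which is \<open>AB = \<delta> B A\<^sup>2\<close>. For the same reason
  \<open>AB - BA\<close> has only a corner, proportional to \<open>\<theta>\<^sub>A\<^sub>1 \<theta>\<^sub>B\<^sub>3\<close>, so that it vanishes as soon as one of
  these two parameters does. Replacing \<open>\<theta>\<^sub>A\<^sub>1\<close> by \<open>0\<close> turns \<open>A\<close> into the limit of
  the \<open>A\<^sub>n\<close>, and replacing \<open>\<theta>\<^sub>B\<^sub>3\<close> by \<open>0\<close> turns \<open>B\<close> into the limit of the \<open>B\<^sub>n\<close>.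

  For the limits it suffices that the norm of \<open>T(a, b, c)\<close> is at most
  \<open>(\<bar>a\<bar> + \<bar>b\<bar> + \<bar>c\<bar>) \<lambda>\<close>, where \<open>\<lambda>\<close> is the constant \<open>lambda_tilde\<close>
  (\<open>Lp_norm_trig_op_le\<close>). This is Hoelder's inequality for \<open>C\<close> and \<open>S\<close> together with the norm of the
  indicator of \<open>[\<alpha>, \<beta>]\<close>: the two factors of \<open>\<lambda>\<close>. Differences and commutators of the operators
  involved are again of the form \<open>T(a, b, c)\<close>, with coefficients that tend to \<open>0\<close>.\<close>

section \<open>Truncations and moments\<close>

definition truncation :: "real \<Rightarrow> real \<Rightarrow> (real \<Rightarrow> real) \<Rightarrow> L0" where
  "truncation a b f = abs_L0 (\<lambda>t. indicator {a..b} t * f t)"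

definition moment :: "(real \<Rightarrow> real) \<Rightarrow> real \<Rightarrow> real \<Rightarrow> L0 \<Rightarrow> real" where
  "moment g u v x = (LINT s:{u..v}|lebesgue. g s * rep_L0 x s)"

lemma truncation_measurable:
  fixes f :: "real \<Rightarrow> real"
  assumes "f \<in> borel_measurable borel"
  shows "(\<lambda>t. indicator {a..b} t * f t) \<in> borel_measurable lebesgue"
proof -
  have "(\<lambda>t. indicator {a..b} t * f t) \<in> borel_measurable borel"
    using assms by measurable
  then show ?thesis by (simp add: measurable_completion)
qed

lemma abs_L0_add:
  assumes "f \<in> borel_measurable lebesgue" "g \<in> borel_measurable lebesgue"
  shows "abs_L0 f + abs_L0 g = abs_L0 (\<lambda>t. f t + g t)"
  using assms by (intro plus_L0.abs_eq) (auto simp: ae_eq_def)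

lemma abs_L0_scaleR:
  assumes "f \<in> borel_measurable lebesgue"
  shows "r *\<^sub>R abs_L0 f = abs_L0 (\<lambda>t. r * f t)"
  using assms by (intro scaleR_L0.abs_eq) (auto simp: ae_eq_def)

lemma truncation_lincomb:
  assumes f: "f \<in> borel_measurable borel" and g: "g \<in> borel_measurable borel"
  shows "r *\<^sub>R truncation a b f + q *\<^sub>R truncation a b g = truncation a b (\<lambda>t. r * f t + q * g t)"
proof -
  note F = truncation_measurable[OF f, of a b]
  note G = truncation_measurable[OF g, of a b]
  show ?thesis
    unfolding truncation_def
    by (subst abs_L0_scaleR[OF F], subst abs_L0_scaleR[OF G], subst abs_L0_add)
      (use F G in \<open>auto simp: algebra_simps intro!: arg_cong[where f = abs_L0]\<close>)
qed

text \<open>When \<open>[u, v]\<close> lies inside \<open>[a, b]\<close>, the truncation is invisible to the moment. This is where the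
  inclusion of \<open>[\<alpha>\<^sub>1, \<beta>\<^sub>1]\<close> in \<open>[\<alpha>, \<beta>]\<close> enters.\<close>
lemma moment_truncation:
  assumes f: "f \<in> borel_measurable borel" and g: "g \<in> borel_measurable borel"
    and "a \<le> u" "v \<le> b"
  shows "moment g u v (truncation a b f) = (LINT s:{u..v}|lebesgue. g s * f s)"
proof -
  have f': "f \<in> borel_measurable lebesgue" and g': "g \<in> borel_measurable lebesgue"
    using f g by (auto simp: measurable_completion)
  have "AE s in lebesgue. s \<in> {u..v} \<longrightarrow> g s * rep_L0 (truncation a b f) s = g s * f s"
    using rep_abs_L0[OF truncation_measurable[OF f, of a b]]
    by eventually_elim (use assms in \<open>auto simp: truncation_def\<close>)
  then show ?thesis
    unfolding moment_def set_lebesgue_integral_def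
    by (intro integral_cong_AE)
      (use f' g' in \<open>auto intro!: borel_measurable_scaleR borel_measurable_times
         borel_measurable_indicator rep_L0_measurable elim!: eventually_mono
         split: split_indicator\<close>)
qed

lemma moment_truncation_lincomb:
  assumes f: "continuous_on UNIV f" and h: "continuous_on UNIV h" and g: "continuous_on UNIV g"
    and "a \<le> u" "v \<le> b"
  shows "moment g u v (r *\<^sub>R truncation a b f + q *\<^sub>R truncation a b h)
    = r * (LINT s:{u..v}|lebesgue. g s * f s) + q * (LINT s:{u..v}|lebesgue. g s * h s)"
proof -
  have meas: "f \<in> borel_measurable borel" "h \<in> borel_measurable borel" "g \<in> borel_measurable borel"
    using f g h by (auto intro: borel_measurable_continuous_onI)
  have cont: "continuous_on {u..v} f" "continuous_on {u..v} h" "continuous_on {u..v} g"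
    using f g h by (auto intro: continuous_on_subset)
  have "moment g u v (r *\<^sub>R truncation a b f + q *\<^sub>R truncation a b h)
      = (LINT s:{u..v}|lebesgue. r * (g s * f s) + q * (g s * h s))"
    using meas assms(4,5)
    by (simp add: truncation_lincomb moment_truncation distrib_left mult.left_commute)
  also have "\<dots> = (LINT s:{u..v}|lebesgue. r * (g s * f s)) + (LINT s:{u..v}|lebesgue. q * (g s * h s))"
    by (rule set_integral_add; rule absolutely_integrable_continuous_real)
      (intro continuous_intros cont)+
  finally show ?thesis by simp
qed

text \<open>A kernel that is a sum of products of a function of \<open>t\<close> and a function of \<open>s\<close> can be integrated
  term by term, because the functions of \<open>s\<close> are bounded and \<open>x\<close> is integrable on bounded intervals.\<close>
lemma integral_op_rank_two:
  assumes p: "1 \<le> p" and x: "x \<in> Lp p"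
    and g: "g\<^sub>1 \<in> borel_measurable borel" "\<And>s. \<bar>g\<^sub>1 s\<bar> \<le> 1"
      "g\<^sub>2 \<in> borel_measurable borel" "\<And>s. \<bar>g\<^sub>2 s\<bar> \<le> 1"
    and f: "f\<^sub>1 \<in> borel_measurable borel" "f\<^sub>2 \<in> borel_measurable borel"
  shows "integral_op (\<lambda>t s. f\<^sub>1 t * g\<^sub>1 s + f\<^sub>2 t * g\<^sub>2 s) u v a b x
    = moment g\<^sub>1 u v x *\<^sub>R truncation a b f\<^sub>1 + moment g\<^sub>2 u v x *\<^sub>R truncation a b f\<^sub>2"
proof -
  have int: "set_integrable lebesgue {u..v} (\<lambda>s. g\<^sub>1 s * rep_L0 x s)"
    "set_integrable lebesgue {u..v} (\<lambda>s. g\<^sub>2 s * rep_L0 x s)"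
    by (intro set_integrable_mult_bounded Lp_imp_set_integrable[OF p x] g)+
  have "(LINT s:{u..v}|lebesgue. indicator {a..b} t * (f\<^sub>1 t * g\<^sub>1 s + f\<^sub>2 t * g\<^sub>2 s) * rep_L0 x s)
      = indicator {a..b} t * (moment g\<^sub>1 u v x * f\<^sub>1 t + moment g\<^sub>2 u v x * f\<^sub>2 t)" for t
  proof -
    have "(LINT s:{u..v}|lebesgue. indicator {a..b} t * (f\<^sub>1 t * g\<^sub>1 s + f\<^sub>2 t * g\<^sub>2 s) * rep_L0 x s)
      = (LINT s:{u..v}|lebesgue. (indicator {a..b} t * f\<^sub>1 t) * (g\<^sub>1 s * rep_L0 x s)
          + (indicator {a..b} t * f\<^sub>2 t) * (g\<^sub>2 s * rep_L0 x s))"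
      by (intro set_lebesgue_integral_cong) (auto simp: algebra_simps)
    also have "\<dots> = (indicator {a..b} t * f\<^sub>1 t) * moment g\<^sub>1 u v x
        + (indicator {a..b} t * f\<^sub>2 t) * moment g\<^sub>2 u v x"
      unfolding moment_def by (subst set_integral_add) (use int in auto)
    finally show ?thesis by (simp add: algebra_simps)
  qed
  then have "integral_op (\<lambda>t s. f\<^sub>1 t * g\<^sub>1 s + f\<^sub>2 t * g\<^sub>2 s) u v a b x
      = truncation a b (\<lambda>t. moment g\<^sub>1 u v x * f\<^sub>1 t + moment g\<^sub>2 u v x * f\<^sub>2 t)"
    by (simp add: integral_op_def truncation_def)
  then show ?thesis using f by (simp add: truncation_lincomb)
qed

section \<open>The algebra of trigonometric kernels\<close>

definition trig_op ::
  "real \<Rightarrow> real \<Rightarrow> real \<Rightarrow> real \<Rightarrow> real \<Rightarrow> real \<Rightarrow> real \<Rightarrow> real \<Rightarrow> L0 \<Rightarrow> L0" where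
  "trig_op \<omega> u v \<alpha> \<beta> a b c =
     integral_op (\<lambda>t s. a * sin (\<omega> * t) * cos (\<omega> * s) + b * cos (\<omega> * t) * cos (\<omega> * s)
                      + c * sin (\<omega> * t) * sin (\<omega> * s)) u v \<alpha> \<beta>"

lemma trig_op_eq:
  assumes p: "1 \<le> p" and x: "x \<in> Lp p"
  shows "trig_op \<omega> u v \<alpha> \<beta> a b c x
    = (a * moment (\<lambda>s. cos (\<omega> * s)) u v x + c * moment (\<lambda>s. sin (\<omega> * s)) u v x)
        *\<^sub>R truncation \<alpha> \<beta> (\<lambda>t. sin (\<omega> * t))
      + (b * moment (\<lambda>s. cos (\<omega> * s)) u v x) *\<^sub>R truncation \<alpha> \<beta> (\<lambda>t. cos (\<omega> * t))"
proof -
  have "trig_op \<omega> u v \<alpha> \<beta> a b c x = integral_op (\<lambda>t s.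
      (a * sin (\<omega> * t) + b * cos (\<omega> * t)) * cos (\<omega> * s) + (c * sin (\<omega> * t) + 0 * cos (\<omega> * t)) * sin (\<omega> * s))
      u v \<alpha> \<beta> x"
    by (simp add: trig_op_def algebra_simps)
  also have "\<dots> = moment (\<lambda>s. cos (\<omega> * s)) u v x *\<^sub>R truncation \<alpha> \<beta> (\<lambda>t. a * sin (\<omega> * t) + b * cos (\<omega> * t))
      + moment (\<lambda>s. sin (\<omega> * s)) u v x *\<^sub>R truncation \<alpha> \<beta> (\<lambda>t. c * sin (\<omega> * t) + 0 * cos (\<omega> * t))"
    by (rule integral_op_rank_two[OF p x]) auto
  also have "truncation \<alpha> \<beta> (\<lambda>t. a * sin (\<omega> * t) + b * cos (\<omega> * t))
      = a *\<^sub>R truncation \<alpha> \<beta> (\<lambda>t. sin (\<omega> * t)) + b *\<^sub>R truncation \<alpha> \<beta> (\<lambda>t. cos (\<omega> * t))"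
    by (rule truncation_lincomb[symmetric]) auto
  also have "truncation \<alpha> \<beta> (\<lambda>t. c * sin (\<omega> * t) + 0 * cos (\<omega> * t))
      = c *\<^sub>R truncation \<alpha> \<beta> (\<lambda>t. sin (\<omega> * t)) + 0 *\<^sub>R truncation \<alpha> \<beta> (\<lambda>t. cos (\<omega> * t))"
    by (rule truncation_lincomb[symmetric]) auto
  finally show ?thesis by (simp add: algebra_simps)
qed

lemma trig_op_in_Lp:
  assumes "1 \<le> p" "x \<in> Lp p"
  shows "trig_op \<omega> u v \<alpha> \<beta> a b c x \<in> Lp p"
  unfolding trig_op_def by (rule integral_op_trig(1)[OF assms])

lemma trig_op_diff:
  assumes "1 \<le> p" "x \<in> Lp p"
  shows "trig_op \<omega> u v \<alpha> \<beta> a\<^sub>1 b\<^sub>1 c\<^sub>1 x - trig_op \<omega> u v \<alpha> \<beta> a\<^sub>2 b\<^sub>2 c\<^sub>2 x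
    = trig_op \<omega> u v \<alpha> \<beta> (a\<^sub>1 - a\<^sub>2) (b\<^sub>1 - b\<^sub>2) (c\<^sub>1 - c\<^sub>2) x"
  by (simp add: trig_op_eq[OF assms] algebra_simps)

lemma trig_op_scaleR:
  assumes "1 \<le> p" "x \<in> Lp p"
  shows "r *\<^sub>R trig_op \<omega> u v \<alpha> \<beta> a b c x = trig_op \<omega> u v \<alpha> \<beta> (r * a) (r * b) (r * c) x"
  by (simp add: trig_op_eq[OF assms] algebra_simps)

text \<open>The composition law is multiplication of upper triangular matrices. By orthogonality
  \<open>trig_op \<omega> u v \<alpha> \<beta> a b c\<close> sends the truncated sine to its multiple by \<open>\<sigma>\<^sub>1 c\<close>, and the truncated
  cosine to \<open>\<sigma>\<^sub>2 a\<close> times the truncated sine plus \<open>\<sigma>\<^sub>2 b\<close> times the truncated cosine.\<close>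
lemma trig_op_compose:
  assumes p: "1 \<le> p" and x: "x \<in> Lp p" and uv: "\<alpha> \<le> u" "v \<le> \<beta>"
    and orth: "(LINT s:{u..v}|lebesgue. sin (\<omega> * s) * cos (\<omega> * s)) = 0"
    and s1: "\<sigma>\<^sub>1 = (LINT s:{u..v}|lebesgue. (sin (\<omega> * s))\<^sup>2)"
    and s2: "\<sigma>\<^sub>2 = (LINT s:{u..v}|lebesgue. (cos (\<omega> * s))\<^sup>2)"
  shows "trig_op \<omega> u v \<alpha> \<beta> a\<^sub>1 b\<^sub>1 c\<^sub>1 (trig_op \<omega> u v \<alpha> \<beta> a\<^sub>2 b\<^sub>2 c\<^sub>2 x)
    = trig_op \<omega> u v \<alpha> \<beta> (a\<^sub>1 * b\<^sub>2 * \<sigma>\<^sub>2 + c\<^sub>1 * a\<^sub>2 * \<sigma>\<^sub>1) (b\<^sub>1 * b\<^sub>2 * \<sigma>\<^sub>2) (c\<^sub>1 * c\<^sub>2 * \<sigma>\<^sub>1) x"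
proof -
  let ?y = "trig_op \<omega> u v \<alpha> \<beta> a\<^sub>2 b\<^sub>2 c\<^sub>2 x"
  let ?C = "moment (\<lambda>s. cos (\<omega> * s)) u v" and ?S = "moment (\<lambda>s. sin (\<omega> * s)) u v"
  have orth': "(LINT s:{u..v}|lebesgue. cos (\<omega> * s) * sin (\<omega> * s)) = 0"
    using orth by (simp add: mult.commute)
  have C: "?C ?y = b\<^sub>2 * \<sigma>\<^sub>2 * ?C x"
    unfolding trig_op_eq[OF p x] s2
    by (subst moment_truncation_lincomb)
      (use uv orth' in \<open>auto intro!: continuous_intros simp: power2_eq_square\<close>)
  have S: "?S ?y = \<sigma>\<^sub>1 * (a\<^sub>2 * ?C x + c\<^sub>2 * ?S x)"
    unfolding trig_op_eq[OF p x] s1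
    by (subst moment_truncation_lincomb)
      (use uv orth in \<open>auto intro!: continuous_intros simp: power2_eq_square\<close>)
  show ?thesis
    by (subst trig_op_eq[OF p trig_op_in_Lp[OF p x]])
      (simp add: C S, simp add: trig_op_eq[OF p x] algebra_simps)
qed

lemma op_A_trig: "op_A \<theta> u v \<alpha> \<beta> \<sigma>\<^sub>1 \<sigma>\<^sub>2 \<delta> \<omega> = trig_op \<omega> u v \<alpha> \<beta> \<theta> (1 / (\<delta> * \<sigma>\<^sub>2)) (1 / (\<delta> * \<sigma>\<^sub>1))"
  by (simp add: op_A_def trig_op_def)

lemma op_B_trig: "op_B \<theta> \<zeta> u v \<alpha> \<beta> \<sigma>\<^sub>1 \<sigma>\<^sub>2 \<omega> = trig_op \<omega> u v \<alpha> \<beta> \<theta> (2 * \<sigma>\<^sub>1 / \<sigma>\<^sub>2 * \<zeta>) \<zeta>"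
  by (simp add: op_B_def trig_op_def)

text \<open>Let \<open>h\<close> be the corner of the matrix of \<open>\<delta>A\<close> and \<open>(d, 2d)\<close> the diagonal of that of \<open>B\<close>. In
  \<open>(\<delta>A) B\<close> the corner \<open>h\<close> meets the second diagonal entry and adds \<open>2dh\<close> to the corner of \<open>B\<close>. In
  \<open>B (\<delta>A)\<^sup>2\<close> it is doubled by squaring, meets the first entry and adds \<open>2dh\<close> as well. This is the
  reason for the factor \<open>2 \<sigma>\<^sub>1 / \<sigma>\<^sub>2\<close> in \<open>op_B\<close>.\<close>
lemma op_A_op_B_covariance:
  assumes p: "1 \<le> p" and x: "x \<in> Lp p" and uv: "\<alpha> \<le> u" "v \<le> \<beta>"
    and orth: "(LINT s:{u..v}|lebesgue. sin (\<omega> * s) * cos (\<omega> * s)) = 0"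
    and s: "\<sigma>\<^sub>1 = (LINT s:{u..v}|lebesgue. (sin (\<omega> * s))\<^sup>2)"
      "\<sigma>\<^sub>2 = (LINT s:{u..v}|lebesgue. (cos (\<omega> * s))\<^sup>2)"
    and nz: "\<delta> \<noteq> 0" "\<sigma>\<^sub>1 \<noteq> 0" "\<sigma>\<^sub>2 \<noteq> 0"
    and A: "A = op_A \<theta>\<^sub>A u v \<alpha> \<beta> \<sigma>\<^sub>1 \<sigma>\<^sub>2 \<delta> \<omega>" and B: "B = op_B \<theta>\<^sub>B \<zeta> u v \<alpha> \<beta> \<sigma>\<^sub>1 \<sigma>\<^sub>2 \<omega>"
  shows "A (B x) = \<delta> *\<^sub>R B (A (A x))"
proof -
  note comp = trig_op_compose[OF p _ uv orth s] and mem = trig_op_in_Lp[OF p x]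
  show ?thesis
    unfolding A B op_A_trig op_B_trig comp[OF mem] comp[OF x] trig_op_scaleR[OF p x]
    by (rule arg_cong3[where f = "\<lambda>a b c. trig_op \<omega> u v \<alpha> \<beta> a b c x"]) (use nz in \<open>simp_all add: field_simps\<close>)
qed

text \<open>The diagonal of the matrix of \<open>\<delta>A\<close> is the identity, so \<open>AB\<close> and \<open>BA\<close> have the same diagonal and
  only the corner survives in their difference.\<close>
lemma op_A_op_B_commutator:
  assumes p: "1 \<le> p" and x: "x \<in> Lp p" and uv: "\<alpha> \<le> u" "v \<le> \<beta>"
    and orth: "(LINT s:{u..v}|lebesgue. sin (\<omega> * s) * cos (\<omega> * s)) = 0"
    and s: "\<sigma>\<^sub>1 = (LINT s:{u..v}|lebesgue. (sin (\<omega> * s))\<^sup>2)"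
      "\<sigma>\<^sub>2 = (LINT s:{u..v}|lebesgue. (cos (\<omega> * s))\<^sup>2)"
    and nz: "\<delta> \<noteq> 0" "\<sigma>\<^sub>1 \<noteq> 0" "\<sigma>\<^sub>2 \<noteq> 0"
    and A: "A = op_A \<theta>\<^sub>A u v \<alpha> \<beta> \<sigma>\<^sub>1 \<sigma>\<^sub>2 \<delta> \<omega>" and B: "B = op_B \<theta>\<^sub>B \<zeta> u v \<alpha> \<beta> \<sigma>\<^sub>1 \<sigma>\<^sub>2 \<omega>"
  shows "A (B x) - B (A x) = trig_op \<omega> u v \<alpha> \<beta> (\<theta>\<^sub>A * \<sigma>\<^sub>1 * \<zeta>) 0 0 x"
proof -
  note comp = trig_op_compose[OF p x uv orth s]
  show ?thesis
    unfolding A B op_A_trig op_B_trig comp trig_op_diff[OF p x]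
    by (rule arg_cong3[where f = "\<lambda>a b c. trig_op \<omega> u v \<alpha> \<beta> a b c x"]) (use nz in \<open>simp_all add: field_simps\<close>)
qed

section \<open>Orthogonality of sine and cosine\<close>

text \<open>The integral is \<open>(sin\<^sup>2 (\<omega>v) - sin\<^sup>2 (\<omega>u)) / (2\<omega>)\<close>, and the numerator factors as
  \<open>sin (\<omega>(v - u)) sin (\<omega>(v + u))\<close>: the two alternatives for \<open>\<omega>\<close> make one factor or the other
  vanish.\<close>
lemma LINT_sin_cos_eq_0:
  fixes \<omega> u v :: real
  assumes "u \<le> v" and \<omega>: "\<omega> / pi * (v - u) \<in> \<int> \<or> \<omega> / pi * (v + u) \<in> \<int>"
  shows "(LINT s:{u..v}|lebesgue. sin (\<omega> * s) * cos (\<omega> * s)) = 0"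
proof (cases "\<omega> = 0")
  case False
  define F where "F = (\<lambda>s. (sin (\<omega> * s))\<^sup>2 / (2 * \<omega>))"
  have "(\<lambda>s. indicator {u..v} s *\<^sub>R (sin (\<omega> * s) * cos (\<omega> * s))) \<in> borel_measurable lborel"
    by measurable
  then have "(LINT s:{u..v}|lebesgue. sin (\<omega> * s) * cos (\<omega> * s))
      = (LINT s:{u..v}|lborel. sin (\<omega> * s) * cos (\<omega> * s))"
    unfolding set_lebesgue_integral_def by (rule integral_completion)
  also have "\<dots> = F v - F u"
    unfolding set_lebesgue_integral_def
    by (rule integral_FTC_atLeastAtMost[OF \<open>u \<le> v\<close>])
      (use False in \<open>auto simp: F_def has_real_derivative_iff_has_vector_derivative[symmetric]
        intro!: derivative_eq_intros continuous_intros\<close>)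
  also have "\<dots> = sin (\<omega> * (v - u)) * sin (\<omega> * (v + u)) / (2 * \<omega>)"
  proof -
    have "(sin (\<omega> * v))\<^sup>2 - (sin (\<omega> * u))\<^sup>2
        = (sin (\<omega> * v))\<^sup>2 * ((sin (\<omega> * u))\<^sup>2 + (cos (\<omega> * u))\<^sup>2) - (sin (\<omega> * u))\<^sup>2 * ((sin (\<omega> * v))\<^sup>2 + (cos (\<omega> * v))\<^sup>2)"
      by simp
    \<comment> \<open>Multiplying by \<open>sin\<^sup>2 + cos\<^sup>2\<close> makes both sides polynomials in the same four values.\<close>
    also have "\<dots> = sin (\<omega> * v - \<omega> * u) * sin (\<omega> * v + \<omega> * u)"
      unfolding sin_diff sin_add by algebra
    finally show ?thesis
      by (simp add: F_def diff_divide_distrib[symmetric] algebra_simps)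
  qed
  also have "sin (\<omega> * (v - u)) * sin (\<omega> * (v + u)) = 0"
  proof -
    have "sin (\<omega> * y) = 0" if "\<omega> / pi * y \<in> \<int>" for y
      using that by (auto elim!: Ints_cases simp: sin_zero_iff_int2 field_simps)
    then show ?thesis using \<omega> by auto
  qed
  finally show ?thesis by simp
qed simp

lemma LINT_cos_squared:
  fixes \<omega> u v :: real
  assumes "u \<le> v"
  shows "(LINT s:{u..v}|lebesgue. (cos (\<omega> * s))\<^sup>2)
    = v - u - (LINT s:{u..v}|lebesgue. (sin (\<omega> * s))\<^sup>2)"
proof -
  have "(LINT s:{u..v}|lebesgue. (cos (\<omega> * s))\<^sup>2) = (LINT s:{u..v}|lebesgue. 1 - (sin (\<omega> * s))\<^sup>2)"
    by (simp add: cos_squared_eq)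
  also have "\<dots> = (LINT s:{u..v}|lebesgue. 1) - (LINT s:{u..v}|lebesgue. (sin (\<omega> * s))\<^sup>2)"
    by (rule set_integral_diff; rule absolutely_integrable_continuous_real) (intro continuous_intros)+
  also have "(LINT s:{u..v}|lebesgue. 1) = v - u"
    using assms by (simp add: set_lebesgue_integral_def)
  finally show ?thesis .
qed

section \<open>Norm estimates\<close>

lemma enn2real_ge_1:
  assumes "1 \<le> p" "p \<noteq> \<infinity>"
  shows "1 \<le> enn2real p"
  using assms by (metis enn2real_1 enn2real_mono infinity_ennreal_def top.not_eq_extremum)

text \<open>Since \<open>enn2real \<infinity> = 0\<close> and division by \<open>0\<close> gives \<open>0\<close>, the term \<open>1 / enn2real p\<close> is the right
  exponent for \<open>p = \<infinity>\<close> too; the three cases of the definition are thus one formula on intervals of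
  positive length. The first factor will bound the functions \<open>e\<^sub>s\<close> and \<open>e\<^sub>c\<close>, the second one the
  moments.\<close>
lemma lambda_tilde_eq:
  assumes "u < v" "\<alpha> < \<beta>"
  shows "lambda_tilde p u v \<alpha> \<beta> = (\<beta> - \<alpha>) powr (1 / enn2real p) * (v - u) powr (1 - 1 / enn2real p)"
  using assms by (auto simp: lambda_tilde_def)

lemma Lp_norm_truncation_le:
  assumes p: "1 \<le> p" and ab: "a < b" and f: "f \<in> borel_measurable borel" and M: "\<And>t. \<bar>f t\<bar> \<le> M"
  shows "Lp_norm p (truncation a b f) \<le> ennreal (M * (b - a) powr (1 / enn2real p))"
proof -
  have M0: "0 \<le> M" using M[of 0] by linarith
  have ae: "AE t in lebesgue. \<bar>rep_L0 (truncation a b f) t\<bar> \<le> M * indicator {a..b} t"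
    using rep_abs_L0[OF truncation_measurable[OF f, of a b]]
    by eventually_elim (use M in \<open>auto simp: truncation_def indicator_def\<close>)
  show ?thesis
  proof (cases "p = \<infinity>")
    case True
    have "esssup lebesgue (\<lambda>t. ennreal \<bar>rep_L0 (truncation a b f) t\<bar>) \<le> ennreal M"
    proof (rule esssup_I)
      show "AE t in lebesgue. ennreal \<bar>rep_L0 (truncation a b f) t\<bar> \<le> ennreal M"
        using ae by eventually_elim (use M0 in \<open>auto intro!: ennreal_leI split: split_indicator_asm\<close>)
    qed auto
    then show ?thesis using True ab by (simp add: Lp_norm_def)
  next
    case False
    define r where "r = enn2real p"
    have r: "1 \<le> r" unfolding r_def by (rule enn2real_ge_1[OF p False])
    define I where "I = (\<integral>\<^sup>+ t. ennreal (\<bar>rep_L0 (truncation a b f) t\<bar> powr r) \<partial>lebesgue)"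
    have "I \<le> (\<integral>\<^sup>+ t. ennreal (M powr r) * indicator {a..b} t \<partial>lebesgue)"
      unfolding I_def
    proof (rule nn_integral_mono_AE, use ae in eventually_elim)
      fix t assume t: "\<bar>rep_L0 (truncation a b f) t\<bar> \<le> M * indicator {a..b} t"
      show "ennreal (\<bar>rep_L0 (truncation a b f) t\<bar> powr r) \<le> ennreal (M powr r) * indicator {a..b} t"
        using t r by (cases "t \<in> {a..b}") (auto intro!: ennreal_leI powr_mono2)
    qed
    also have "\<dots> = ennreal (M powr r) * emeasure lebesgue {a..b}"
      by (rule nn_integral_cmult_indicator) auto
    also have "\<dots> = ennreal (M powr r * (b - a))"
      using ab by (simp add: ennreal_mult)
    finally have I: "I \<le> ennreal (M powr r * (b - a))" .
    then have "I \<noteq> \<infinity>" by (auto simp: top_unique)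
    have "enn2real I \<le> M powr r * (b - a)"
      using enn2real_mono[OF I] ab by simp
    then have "enn2real I powr (1 / r) \<le> (M powr r * (b - a)) powr (1 / r)"
      using r by (intro powr_mono2) auto
    also have "\<dots> = M * (b - a) powr (1 / r)"
      using r M0 ab by (simp add: powr_mult powr_powr)
    finally show ?thesis
      using False \<open>I \<noteq> \<infinity>\<close> by (simp add: Lp_norm_def Let_def I_def[symmetric] r_def[symmetric] ennreal_leI)
  qed
qed

text \<open>Young's inequality for \<open>y / m\<close> and \<open>1\<close>: the convex function \<open>y powr r\<close> lies above its tangent at
  \<open>m\<close>. Its right-hand side is linear in \<open>y powr r\<close>, so it can be integrated; the choice of \<open>m\<close> is left
  open to be optimised afterwards.\<close>
lemma Young_tangent:
  fixes y m r :: real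
  assumes r: "1 \<le> r" and m: "0 < m" and y: "0 \<le> y"
  shows "y \<le> m powr (1 - r) / r * y powr r + m * (1 - 1 / r)"
proof (cases "y = 0")
  case False
  have "((y / m) powr r) powr (1 / r) * 1 powr (1 - 1 / r) \<le> 1 / r * (y / m) powr r + (1 - 1 / r) * 1"
    using r m y False by (intro Youngs_inequality_0) auto
  then have "y / m \<le> 1 / r * (y / m) powr r + (1 - 1 / r)"
    using r m y by (simp add: powr_powr)
  then have "m * (y / m) \<le> m * (1 / r * (y / m) powr r + (1 - 1 / r))"
    using m by (intro mult_left_mono) auto
  also have "\<dots> = m powr (1 - r) / r * y powr r + m * (1 - 1 / r)"
    using m y by (simp add: powr_divide powr_diff field_simps)
  finally show ?thesis using m by simp
qed (use r m in auto)

text \<open>Hoelder's inequality against a function bounded by \<open>1\<close> on an interval. For finite \<open>p\<close>, the tangent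
  inequality is integrated and \<open>m\<close> is then chosen to minimise the resulting bound; if \<open>x\<close> vanishes
  almost everywhere, that choice would be \<open>m = 0\<close>, and \<open>m\<close> tends to \<open>0\<close> instead.\<close>
lemma moment_le:
  assumes p: "1 \<le> p" and x: "x \<in> Lp p" and uv: "u < v"
    and g: "g \<in> borel_measurable borel" "\<And>s. \<bar>g s\<bar> \<le> 1"
  shows "\<bar>moment g u v x\<bar> \<le> (v - u) powr (1 - 1 / enn2real p) * enn2real (Lp_norm p x)"
proof -
  define L where "L = v - u"
  have L: "0 < L" using uv by (simp add: L_def)
  define h where "h = (\<lambda>s. indicator {u..v} s * (g s * rep_L0 x s))"
  have "set_integrable lebesgue {u..v} (\<lambda>s. g s * rep_L0 x s)"
    by (intro set_integrable_mult_bounded Lp_imp_set_integrable[OF p x] g)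
  then have h: "integrable lebesgue h" by (simp add: set_integrable_def h_def)
  have hx: "\<bar>h s\<bar> \<le> \<bar>rep_L0 x s\<bar> * indicator {u..v} s" for s
    using mult_right_mono[OF g(2)[of s], of "\<bar>rep_L0 x s\<bar>"] by (auto simp: h_def abs_mult split: split_indicator)
  have ind: "integrable lebesgue (indicator {u..v} :: real \<Rightarrow> real)"
    using uv by (auto intro!: integrable_real_indicator)
  have indL: "(LINT s|lebesgue. indicator {u..v} s) = L"
    using uv by (simp add: L_def)
  have mom: "\<bar>moment g u v x\<bar> \<le> (LINT s|lebesgue. \<bar>h s\<bar>)"
    unfolding moment_def set_lebesgue_integral_def
    using integral_abs_bound[of lebesgue h] by (simp add: h_def)
  show ?thesis
  proof (cases "p = \<infinity>")
    case True
    define N where "N = enn2real (Lp_norm p x)"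
    have fin: "Lp_norm p x = ennreal N"
      using x by (simp add: N_def Lp_def ennreal_enn2real)
    have "AE s in lebesgue. ennreal \<bar>rep_L0 x s\<bar> \<le> esssup lebesgue (\<lambda>t. ennreal \<bar>rep_L0 x t\<bar>)"
      by (rule esssup_AE)
    moreover have "esssup lebesgue (\<lambda>t. ennreal \<bar>rep_L0 x t\<bar>) = ennreal N"
      using fin True by (simp add: Lp_norm_def)
    ultimately have "AE s in lebesgue. ennreal \<bar>rep_L0 x s\<bar> \<le> ennreal N" by simp
    then have ae: "AE s in lebesgue. \<bar>rep_L0 x s\<bar> \<le> N"
      by eventually_elim (simp add: N_def)
    have "(LINT s|lebesgue. \<bar>h s\<bar>) \<le> (LINT s|lebesgue. N * indicator {u..v} s)"
    proof (rule integral_mono_AE)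
      show "AE s in lebesgue. \<bar>h s\<bar> \<le> N * indicator {u..v} s"
        using ae
      proof eventually_elim
        fix s assume "\<bar>rep_L0 x s\<bar> \<le> N"
        then show "\<bar>h s\<bar> \<le> N * indicator {u..v} s"
          using order_trans[OF hx[of s] mult_right_mono] by simp
      qed
    qed (intro integrable_abs integrable_mult_right h ind)+
    also have "\<dots> = N * L" using indL by simp
    finally show ?thesis
      using mom True uv by (simp add: L_def N_def mult.commute)
  next
    case False
    define r where "r = enn2real p"
    have r: "1 \<le> r" unfolding r_def by (rule enn2real_ge_1[OF p False])
    define I where "I = (\<integral>\<^sup>+ t. ennreal (\<bar>rep_L0 x t\<bar> powr r) \<partial>lebesgue)"
    have I: "I < \<infinity>"
      using x False by (auto simp: Lp_def Lp_norm_def Let_def I_def r_def top.not_eq_extremum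
          split: if_splits)
    define J where "J = enn2real I"
    have norm: "enn2real (Lp_norm p x) = J powr (1 / r)"
      using I False by (simp add: Lp_norm_def Let_def I_def[symmetric] r_def[symmetric] J_def)
    have J0: "0 \<le> J" by (simp add: J_def)
    have meas: "(\<lambda>t. \<bar>rep_L0 x t\<bar> powr r) \<in> borel_measurable lebesgue"
      by measurable
    have xr: "integrable lebesgue (\<lambda>t. \<bar>rep_L0 x t\<bar> powr r)"
      using I by (intro integrableI_nonneg meas) (auto simp: I_def)
    have intJ: "(LINT t|lebesgue. \<bar>rep_L0 x t\<bar> powr r) = J"
      unfolding J_def I_def by (rule integral_eq_nn_integral[OF meas]) auto
    have bound: "\<bar>moment g u v x\<bar> \<le> m powr (1 - r) / r * J + m * (1 - 1 / r) * L" if m: "0 < m" for m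
    proof -
      have "(LINT s|lebesgue. \<bar>h s\<bar>) \<le> (LINT s|lebesgue. m powr (1 - r) / r * \<bar>rep_L0 x s\<bar> powr r
          + m * (1 - 1 / r) * indicator {u..v} s)"
      proof (rule integral_mono)
        fix s
        show "\<bar>h s\<bar> \<le> m powr (1 - r) / r * \<bar>rep_L0 x s\<bar> powr r + m * (1 - 1 / r) * indicator {u..v} s"
        proof (cases "s \<in> {u..v}")
          case True
          then show ?thesis
            using hx[of s] Young_tangent[OF r m, of "\<bar>rep_L0 x s\<bar>"] by simp
        next
          case False
          then show ?thesis using r by (simp add: h_def)
        qed
      qed (intro integrable_abs integrable_mult_right Bochner_Integration.integrable_add h xr ind)+
      also have "\<dots> = m powr (1 - r) / r * J + m * (1 - 1 / r) * L"
        using xr ind intJ indL by simp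
      finally show ?thesis using mom by linarith
    qed
    show ?thesis
    proof (cases "J = 0")
      case True
      have "\<bar>moment g u v x\<bar> \<le> 0 + e" if "0 < e" for e
      proof -
        have "\<bar>moment g u v x\<bar> \<le> e / L * (1 - 1 / r) * L"
          using bound[of "e / L"] True that L by simp
        also have "\<dots> \<le> e" using that L r by (simp add: field_simps)
        finally show ?thesis by simp
      qed
      then have "\<bar>moment g u v x\<bar> \<le> 0" by (rule field_le_epsilon)
      then show ?thesis by simp
    next
      case False
      with J0 have J: "0 < J" by simp
      \<comment> \<open>The point where the derivative of the bound in \<open>m\<close> is zero, if \<open>r > 1\<close>.\<close>
      define m where "m = (J / L) powr (1 / r)"
      have m: "0 < m" using J L by (simp add: m_def)
      have "m powr r = J / L" using r J L by (simp add: m_def powr_powr)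
      then have "m powr (1 - r) * J = m * L"
        using m J L by (simp add: powr_diff)
      then have "m powr (1 - r) / r * J + m * (1 - 1 / r) * L = m * L"
        using r by (simp add: field_simps)
      also have "\<dots> = L powr (1 - 1 / r) * J powr (1 / r)"
        using J L by (simp add: m_def powr_divide powr_diff)
      finally show ?thesis
        using bound[OF m] by (simp add: norm L_def r_def)
    qed
  qed
qed

text \<open>The image of \<open>x\<close> is a truncation of a function bounded by \<open>(\<bar>a\<bar> + \<bar>b\<bar> + \<bar>c\<bar>)\<close> times a common bound
  for the two moments of \<open>x\<close>. Bounding the function pointwise rather than summing norms avoids the
  triangle inequality in \<open>Lp p\<close>.\<close>
lemma Lp_norm_trig_op_le:
  assumes p: "1 \<le> p" and x: "x \<in> Lp p" and uv: "u < v" "\<alpha> \<le> u" "v \<le> \<beta>"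
  shows "Lp_norm p (trig_op \<omega> u v \<alpha> \<beta> a b c x)
    \<le> ennreal ((\<bar>a\<bar> + \<bar>b\<bar> + \<bar>c\<bar>) * lambda_tilde p u v \<alpha> \<beta> * enn2real (Lp_norm p x))"
proof -
  define Q where "Q = (v - u) powr (1 - 1 / enn2real p) * enn2real (Lp_norm p x)"
  define C where "C = moment (\<lambda>s. cos (\<omega> * s)) u v x"
  define S where "S = moment (\<lambda>s. sin (\<omega> * s)) u v x"
  have C: "\<bar>C\<bar> \<le> Q" and S: "\<bar>S\<bar> \<le> Q"
    unfolding C_def S_def Q_def by (rule moment_le[OF p x uv(1)]; simp)+
  have Q0: "0 \<le> Q" using C by linarith
  have *: "\<bar>k * y\<bar> \<le> \<bar>k\<bar>" if "\<bar>y\<bar> \<le> 1" for k y :: real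
    using that by (simp add: abs_mult mult_left_le)
  have **: "\<bar>k * M\<bar> \<le> \<bar>k\<bar> * Q" if "\<bar>M\<bar> \<le> Q" for k M
    using that by (simp add: abs_mult mult_left_mono)
  have bound: "\<bar>(a * C + c * S) * sin (\<omega> * t) + (b * C) * cos (\<omega> * t)\<bar> \<le> (\<bar>a\<bar> + \<bar>b\<bar> + \<bar>c\<bar>) * Q" for t
  proof -
    have "\<bar>(a * C + c * S) * sin (\<omega> * t) + (b * C) * cos (\<omega> * t)\<bar> \<le> \<bar>a * C + c * S\<bar> + \<bar>b * C\<bar>"
      using *[of "sin (\<omega> * t)" "a * C + c * S"] *[of "cos (\<omega> * t)" "b * C"]
      by (auto intro: order_trans[OF abs_triangle_ineq add_mono])
    also have "\<dots> \<le> (\<bar>a\<bar> + \<bar>b\<bar> + \<bar>c\<bar>) * Q"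
      using **[OF C, of a] **[OF S, of c] **[OF C, of b] abs_triangle_ineq[of "a * C" "c * S"]
      by (simp add: algebra_simps)
    finally show ?thesis .
  qed
  have "trig_op \<omega> u v \<alpha> \<beta> a b c x
      = truncation \<alpha> \<beta> (\<lambda>t. (a * C + c * S) * sin (\<omega> * t) + (b * C) * cos (\<omega> * t))"
    unfolding trig_op_eq[OF p x] C_def S_def by (rule truncation_lincomb) auto
  also have "Lp_norm p \<dots> \<le> ennreal ((\<bar>a\<bar> + \<bar>b\<bar> + \<bar>c\<bar>) * Q * (\<beta> - \<alpha>) powr (1 / enn2real p))"
    by (rule Lp_norm_truncation_le[OF p _ _ bound]) (use uv in auto)
  also have "(\<bar>a\<bar> + \<bar>b\<bar> + \<bar>c\<bar>) * Q * (\<beta> - \<alpha>) powr (1 / enn2real p)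
      = (\<bar>a\<bar> + \<bar>b\<bar> + \<bar>c\<bar>) * lambda_tilde p u v \<alpha> \<beta> * enn2real (Lp_norm p x)"
    using uv by (simp add: lambda_tilde_eq Q_def)
  finally show ?thesis .
qed

lemma conv_in_norm_trig_op:
  assumes p: "1 \<le> p" and uv: "u < v" "\<alpha> \<le> u" "v \<le> \<beta>"
    and diff: "\<And>n x. x \<in> Lp p \<Longrightarrow> T n x - S x = trig_op \<omega> u v \<alpha> \<beta> (a n) (b n) (c n) x"
    and lim: "a \<longlonglongrightarrow> 0" "b \<longlonglongrightarrow> 0" "c \<longlonglongrightarrow> 0"
  shows "conv_in_norm p T S"
proof -
  let ?K = "\<lambda>n. (\<bar>a n\<bar> + \<bar>b n\<bar> + \<bar>c n\<bar>) * lambda_tilde p u v \<alpha> \<beta>"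
  have lam: "0 \<le> lambda_tilde p u v \<alpha> \<beta>"
    by (simp add: lambda_tilde_def)
  have bound: "op_norm p (\<lambda>x. T n x - S x) \<le> ennreal (?K n)" for n
    unfolding op_norm_def
  proof (rule SUP_least)
    fix x assume "x \<in> {x. Lp_norm p x \<le> 1}"
    then have x1: "Lp_norm p x \<le> 1" by simp
    then have x: "x \<in> Lp p" by (simp add: Lp_def order_le_less_trans)
    have "enn2real (Lp_norm p x) \<le> 1" using enn2real_mono[OF x1] by simp
    then have "?K n * enn2real (Lp_norm p x) \<le> ?K n"
      using lam by (intro mult_left_le) auto
    then show "Lp_norm p (T n x - S x) \<le> ennreal (?K n)"
      unfolding diff[OF x] using Lp_norm_trig_op_le[OF p x uv] order_trans ennreal_leI by blast
  qed
  have "(\<lambda>n. ennreal (?K n)) \<longlonglongrightarrow> ennreal ((\<bar>0\<bar> + \<bar>0\<bar> + \<bar>0\<bar>) * lambda_tilde p u v \<alpha> \<beta>)"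
    by (intro tendsto_ennrealI tendsto_intros lim)
  then have lim0: "(\<lambda>n. ennreal (?K n)) \<longlonglongrightarrow> 0" by simp
  show ?thesis
    unfolding conv_in_norm_def
    by (rule tendsto_sandwich[OF _ _ tendsto_const lim0]) (simp_all add: bound)
qed

text \<open>The bound has the form of the quantity that is assumed to tend to \<open>0\<close> in the last part of the
  theorem, times the norm of a fixed \<open>x\<close>; it is uniform over the parameter set.\<close>
lemma Lp_norm_commutator_le:
  assumes p: "1 \<le> p" and x: "x \<in> Lp p"
    and l: "(a\<^sub>1, b\<^sub>1, b\<^sub>3, u\<^sub>1, v\<^sub>1, u, v, s\<^sub>1, s\<^sub>2, d, w) \<in> Lambda"
  shows "Lp_norm p (op_A a\<^sub>1 u\<^sub>1 v\<^sub>1 u v s\<^sub>1 s\<^sub>2 d w (op_B b\<^sub>1 b\<^sub>3 u\<^sub>1 v\<^sub>1 u v s\<^sub>1 s\<^sub>2 w x)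
                  - op_B b\<^sub>1 b\<^sub>3 u\<^sub>1 v\<^sub>1 u v s\<^sub>1 s\<^sub>2 w (op_A a\<^sub>1 u\<^sub>1 v\<^sub>1 u v s\<^sub>1 s\<^sub>2 d w x))
    \<le> ennreal (\<bar>a\<^sub>1 * s\<^sub>1 * b\<^sub>3 * lambda_tilde p u\<^sub>1 v\<^sub>1 u v\<bar> * enn2real (Lp_norm p x))"
proof -
  have uv: "u\<^sub>1 < v\<^sub>1" "u \<le> u\<^sub>1" "v\<^sub>1 \<le> v" and nz: "d \<noteq> 0" "s\<^sub>1 \<noteq> 0" "s\<^sub>2 \<noteq> 0"
    and orth: "(LINT s:{u\<^sub>1..v\<^sub>1}|lebesgue. sin (w * s) * cos (w * s)) = 0"
    and s1: "s\<^sub>1 = (LINT s:{u\<^sub>1..v\<^sub>1}|lebesgue. (sin (w * s))\<^sup>2)"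
    and s2: "s\<^sub>2 = v\<^sub>1 - u\<^sub>1 - s\<^sub>1"
    using l unfolding Lambda_def by blast+
  have s2': "s\<^sub>2 = (LINT s:{u\<^sub>1..v\<^sub>1}|lebesgue. (cos (w * s))\<^sup>2)"
    using LINT_cos_squared[of u\<^sub>1 v\<^sub>1 w] uv(1) s1 s2 by simp
  have lam: "0 \<le> lambda_tilde p u\<^sub>1 v\<^sub>1 u v" by (simp add: lambda_tilde_def)
  show ?thesis
    unfolding op_A_op_B_commutator[OF p x uv(2,3) orth s1 s2' nz refl refl]
    using Lp_norm_trig_op_le[OF p x uv, of w "a\<^sub>1 * s\<^sub>1 * b\<^sub>3" 0 0] lam by (simp add: abs_mult)
qed

section \<open>Commutation relations and limits\<close>

theorem theorem5:
  fixes p :: ennreal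
    and \<theta>\<^sub>A\<^sub>1 \<theta>\<^sub>B\<^sub>1 \<theta>\<^sub>B\<^sub>3 \<omega> \<delta> \<alpha> \<beta> \<alpha>\<^sub>1 \<beta>\<^sub>1 \<sigma>\<^sub>1 \<sigma>\<^sub>2 :: real
    and \<theta> \<zeta> :: "nat \<Rightarrow> real"
    and A B A' B' :: "L0 \<Rightarrow> L0"
    and An Bn :: "nat \<Rightarrow> L0 \<Rightarrow> L0"
  assumes p: "1 \<le> p"
    and \<delta>: "\<delta> \<noteq> 0"
    and intervals: "\<alpha>\<^sub>1 < \<beta>\<^sub>1" "\<alpha> \<le> \<alpha>\<^sub>1" "\<beta> \<ge> \<beta>\<^sub>1"
    and \<omega>: "\<omega> / pi * (\<beta>\<^sub>1 - \<alpha>\<^sub>1) \<in> \<int> \<or> \<omega> / pi * (\<beta>\<^sub>1 + \<alpha>\<^sub>1) \<in> \<int>"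
    and \<sigma>\<^sub>1_def: "\<sigma>\<^sub>1 = (LINT s:{\<alpha>\<^sub>1..\<beta>\<^sub>1}|lebesgue. (sin (\<omega> * s))\<^sup>2)"
    and \<sigma>\<^sub>2_def: "\<sigma>\<^sub>2 = (LINT s:{\<alpha>\<^sub>1..\<beta>\<^sub>1}|lebesgue. (cos (\<omega> * s))\<^sup>2)"
    and \<sigma>: "\<sigma>\<^sub>1 \<noteq> 0" "\<sigma>\<^sub>2 \<noteq> 0"
    and A_def: "A = op_A \<theta>\<^sub>A\<^sub>1 \<alpha>\<^sub>1 \<beta>\<^sub>1 \<alpha> \<beta> \<sigma>\<^sub>1 \<sigma>\<^sub>2 \<delta> \<omega>"
    and B_def: "B = op_B \<theta>\<^sub>B\<^sub>1 \<theta>\<^sub>B\<^sub>3 \<alpha>\<^sub>1 \<beta>\<^sub>1 \<alpha> \<beta> \<sigma>\<^sub>1 \<sigma>\<^sub>2 \<omega>"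
    and An_def: "\<And>n. An n = op_A (\<theta> n) \<alpha>\<^sub>1 \<beta>\<^sub>1 \<alpha> \<beta> \<sigma>\<^sub>1 \<sigma>\<^sub>2 \<delta> \<omega>"
    and Bn_def: "\<And>n. Bn n = op_B \<theta>\<^sub>B\<^sub>1 (\<zeta> n) \<alpha>\<^sub>1 \<beta>\<^sub>1 \<alpha> \<beta> \<sigma>\<^sub>1 \<sigma>\<^sub>2 \<omega>"
    and A'_def: "A' = integral_op (\<lambda>t s. 1 / (\<delta> * \<sigma>\<^sub>2) * cos (\<omega> * t) * cos (\<omega> * s)
                                       + 1 / (\<delta> * \<sigma>\<^sub>1) * sin (\<omega> * t) * sin (\<omega> * s)) \<alpha>\<^sub>1 \<beta>\<^sub>1 \<alpha> \<beta>"
    and B'_def: "B' = integral_op (\<lambda>t s. \<theta>\<^sub>B\<^sub>1 * sin (\<omega> * t) * cos (\<omega> * s)) \<alpha>\<^sub>1 \<beta>\<^sub>1 \<alpha> \<beta>"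
  shows
    "((\<forall>x\<in>Lp p. A (B x) = \<delta> *\<^sub>R B (A (A x)))
      \<and> (\<forall>n\<ge>1. \<forall>x\<in>Lp p. An n (B x) = \<delta> *\<^sub>R B (An n (An n x)))
      \<and> (\<forall>n\<ge>1. \<forall>x\<in>Lp p. An n (Bn n x) = \<delta> *\<^sub>R Bn n (An n (An n x)))
      \<and> (\<forall>n\<ge>1. \<forall>x\<in>Lp p. A (Bn n x) = \<delta> *\<^sub>R Bn n (A (A x)))
      \<and> (\<forall>x\<in>Lp p. AE t in lebesgue. rep_L0 (A (B x) - B (A x)) t =
            \<theta>\<^sub>A\<^sub>1 * \<sigma>\<^sub>1 * \<theta>\<^sub>B\<^sub>3 * (LINT s:{\<alpha>\<^sub>1..\<beta>\<^sub>1}|lebesgue.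
              indicator {\<alpha>..\<beta>} t * sin (\<omega> * t) * cos (\<omega> * s) * rep_L0 x s)))
    \<and> (\<theta> \<longlonglongrightarrow> 0 \<longrightarrow>
        conv_in_norm p An A'
        \<and> conv_in_norm p (\<lambda>n x. An n (B x) - B (An n x)) (\<lambda>x. 0)
        \<and> (\<forall>x\<in>Lp p. A' (B x) = B (A' x)))
    \<and> (\<zeta> \<longlonglongrightarrow> 0 \<longrightarrow>
        conv_in_norm p Bn B'
        \<and> conv_in_norm p (\<lambda>n x. A (Bn n x) - Bn n (A x)) (\<lambda>x. 0)
        \<and> (\<forall>x\<in>Lp p. A (B' x) = B' (A x)))
    \<and> (\<theta> \<longlonglongrightarrow> 0 \<longrightarrow> \<zeta> \<longlonglongrightarrow> 0 \<longrightarrow>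
        conv_in_norm p (\<lambda>n x. An n (Bn n x) - Bn n (An n x)) (\<lambda>x. 0)
        \<and> (\<forall>x\<in>Lp p. A' (B' x) = B' (A' x)))
    \<and> (\<forall>l\<^sub>0\<in>closure Lambda.
        ((\<lambda>(a\<^sub>1, b\<^sub>1, b\<^sub>3, u\<^sub>1, v\<^sub>1, u, v, s\<^sub>1, s\<^sub>2, d, w).
            a\<^sub>1 * s\<^sub>1 * b\<^sub>3 * lambda_tilde p u\<^sub>1 v\<^sub>1 u v) \<longlongrightarrow> 0) (at l\<^sub>0 within Lambda)
        \<longrightarrow> (\<forall>x\<in>Lp p.
          ((\<lambda>(a\<^sub>1, b\<^sub>1, b\<^sub>3, u\<^sub>1, v\<^sub>1, u, v, s\<^sub>1, s\<^sub>2, d, w).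
            Lp_norm p (op_A a\<^sub>1 u\<^sub>1 v\<^sub>1 u v s\<^sub>1 s\<^sub>2 d w (op_B b\<^sub>1 b\<^sub>3 u\<^sub>1 v\<^sub>1 u v s\<^sub>1 s\<^sub>2 w x)
                       - op_B b\<^sub>1 b\<^sub>3 u\<^sub>1 v\<^sub>1 u v s\<^sub>1 s\<^sub>2 w (op_A a\<^sub>1 u\<^sub>1 v\<^sub>1 u v s\<^sub>1 s\<^sub>2 d w x)))
            \<longlongrightarrow> 0) (at l\<^sub>0 within Lambda)))"
proof -
  note uv = intervals
  have orth: "(LINT s:{\<alpha>\<^sub>1..\<beta>\<^sub>1}|lebesgue. sin (\<omega> * s) * cos (\<omega> * s)) = 0"
    using uv(1) \<omega> by (intro LINT_sin_cos_eq_0) auto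
  let ?A = "\<lambda>\<tau>. op_A \<tau> \<alpha>\<^sub>1 \<beta>\<^sub>1 \<alpha> \<beta> \<sigma>\<^sub>1 \<sigma>\<^sub>2 \<delta> \<omega>"
  let ?B = "\<lambda>\<eta>. op_B \<theta>\<^sub>B\<^sub>1 \<eta> \<alpha>\<^sub>1 \<beta>\<^sub>1 \<alpha> \<beta> \<sigma>\<^sub>1 \<sigma>\<^sub>2 \<omega>"
  let ?T = "trig_op \<omega> \<alpha>\<^sub>1 \<beta>\<^sub>1 \<alpha> \<beta>"
  note ops = A_def B_def An_def Bn_def
  have A': "A' = ?A 0" by (simp add: A'_def op_A_def)
  have B': "B' = ?B 0" by (simp add: B'_def op_B_def)
  have cov: "?A \<tau> (?B \<eta> x) = \<delta> *\<^sub>R ?B \<eta> (?A \<tau> (?A \<tau> x))" if "x \<in> Lp p" for \<tau> \<eta> x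
    by (rule op_A_op_B_covariance[OF p that uv(2,3) orth \<sigma>\<^sub>1_def \<sigma>\<^sub>2_def \<delta> \<sigma> refl refl])
  have comm: "?A \<tau> (?B \<eta> x) - ?B \<eta> (?A \<tau> x) = ?T (\<tau> * \<sigma>\<^sub>1 * \<eta>) 0 0 x" if "x \<in> Lp p" for \<tau> \<eta> x
    by (rule op_A_op_B_commutator[OF p that uv(2,3) orth \<sigma>\<^sub>1_def \<sigma>\<^sub>2_def \<delta> \<sigma> refl refl])
  have T0: "?T 0 0 0 x = 0" if "x \<in> Lp p" for x
    using trig_op_eq[OF p that] by simp
  have commute: "?A 0 (?B \<eta> x) = ?B \<eta> (?A 0 x)" "?A \<tau> (?B 0 x) = ?B 0 (?A \<tau> x)"
    if "x \<in> Lp p" for \<tau> \<eta> x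
    using comm[OF that, of 0 \<eta>] comm[OF that, of \<tau> 0] T0[OF that] by simp_all
  note conv = conv_in_norm_trig_op[OF p uv]

  have formula: "AE t in lebesgue. rep_L0 (A (B x) - B (A x)) t =
            \<theta>\<^sub>A\<^sub>1 * \<sigma>\<^sub>1 * \<theta>\<^sub>B\<^sub>3 * (LINT s:{\<alpha>\<^sub>1..\<beta>\<^sub>1}|lebesgue.
              indicator {\<alpha>..\<beta>} t * sin (\<omega> * t) * cos (\<omega> * s) * rep_L0 x s)" if x: "x \<in> Lp p" for x
    unfolding ops comm[OF x] trig_op_def
    using integral_op_trig(2)[OF p x, of "\<theta>\<^sub>A\<^sub>1 * \<sigma>\<^sub>1 * \<theta>\<^sub>B\<^sub>3" \<omega> 0 0 \<alpha>\<^sub>1 \<beta>\<^sub>1 \<alpha> \<beta>]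
  proof eventually_elim
    case (elim t)
    then show ?case
      unfolding set_integral_mult_right[symmetric] by (simp add: mult_ac)
  qed

  have 2: "conv_in_norm p An A' \<and> conv_in_norm p (\<lambda>n x. An n (B x) - B (An n x)) (\<lambda>x. 0)"
    if lim: "\<theta> \<longlonglongrightarrow> 0"
  proof
    show "conv_in_norm p An A'"
      unfolding A' ops op_A_trig
      by (rule conv[where a = \<theta> and b = "\<lambda>_. 0" and c = "\<lambda>_. 0"]) (simp_all add: trig_op_diff[OF p] lim)
    have "(\<lambda>n. \<theta> n * \<sigma>\<^sub>1 * \<theta>\<^sub>B\<^sub>3) \<longlonglongrightarrow> 0 * \<sigma>\<^sub>1 * \<theta>\<^sub>B\<^sub>3" by (intro tendsto_intros lim)
    then show "conv_in_norm p (\<lambda>n x. An n (B x) - B (An n x)) (\<lambda>x. 0)"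
      unfolding ops
      by (intro conv[where a = "\<lambda>n. \<theta> n * \<sigma>\<^sub>1 * \<theta>\<^sub>B\<^sub>3" and b = "\<lambda>_. 0" and c = "\<lambda>_. 0"]) (simp_all add: comm)
  qed
  have 3: "conv_in_norm p Bn B' \<and> conv_in_norm p (\<lambda>n x. A (Bn n x) - Bn n (A x)) (\<lambda>x. 0)"
    if lim: "\<zeta> \<longlonglongrightarrow> 0"
  proof
    have "(\<lambda>n. 2 * \<sigma>\<^sub>1 / \<sigma>\<^sub>2 * \<zeta> n) \<longlonglongrightarrow> 2 * \<sigma>\<^sub>1 / \<sigma>\<^sub>2 * 0" by (intro tendsto_intros lim)
    then show "conv_in_norm p Bn B'"
      unfolding B' ops op_B_trig
      by (intro conv[where a = "\<lambda>_. 0" and b = "\<lambda>n. 2 * \<sigma>\<^sub>1 / \<sigma>\<^sub>2 * \<zeta> n" and c = \<zeta>])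
        (simp_all add: trig_op_diff[OF p] lim)
    have "(\<lambda>n. \<theta>\<^sub>A\<^sub>1 * \<sigma>\<^sub>1 * \<zeta> n) \<longlonglongrightarrow> \<theta>\<^sub>A\<^sub>1 * \<sigma>\<^sub>1 * 0" by (intro tendsto_intros lim)
    then show "conv_in_norm p (\<lambda>n x. A (Bn n x) - Bn n (A x)) (\<lambda>x. 0)"
      unfolding ops
      by (intro conv[where a = "\<lambda>n. \<theta>\<^sub>A\<^sub>1 * \<sigma>\<^sub>1 * \<zeta> n" and b = "\<lambda>_. 0" and c = "\<lambda>_. 0"]) (simp_all add: comm)
  qed
  have 4: "conv_in_norm p (\<lambda>n x. An n (Bn n x) - Bn n (An n x)) (\<lambda>x. 0)"
    if lim: "\<theta> \<longlonglongrightarrow> 0" "\<zeta> \<longlonglongrightarrow> 0"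
  proof -
    have "(\<lambda>n. \<theta> n * \<sigma>\<^sub>1 * \<zeta> n) \<longlonglongrightarrow> 0 * \<sigma>\<^sub>1 * 0" by (intro tendsto_intros lim)
    then show ?thesis
      unfolding ops
      by (intro conv[where a = "\<lambda>n. \<theta> n * \<sigma>\<^sub>1 * \<zeta> n" and b = "\<lambda>_. 0" and c = "\<lambda>_. 0"]) (simp_all add: comm)
  qed

  have 5: "((\<lambda>(a\<^sub>1, b\<^sub>1, b\<^sub>3, u\<^sub>1, v\<^sub>1, u, v, s\<^sub>1, s\<^sub>2, d, w).
            Lp_norm p (op_A a\<^sub>1 u\<^sub>1 v\<^sub>1 u v s\<^sub>1 s\<^sub>2 d w (op_B b\<^sub>1 b\<^sub>3 u\<^sub>1 v\<^sub>1 u v s\<^sub>1 s\<^sub>2 w x)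
                       - op_B b\<^sub>1 b\<^sub>3 u\<^sub>1 v\<^sub>1 u v s\<^sub>1 s\<^sub>2 w (op_A a\<^sub>1 u\<^sub>1 v\<^sub>1 u v s\<^sub>1 s\<^sub>2 d w x)))
            \<longlongrightarrow> 0) (at l\<^sub>0 within Lambda)" (is "(?G \<longlongrightarrow> 0) _")
    if lim: "((\<lambda>(a\<^sub>1, b\<^sub>1, b\<^sub>3, u\<^sub>1, v\<^sub>1, u, v, s\<^sub>1, s\<^sub>2, d, w).
            a\<^sub>1 * s\<^sub>1 * b\<^sub>3 * lambda_tilde p u\<^sub>1 v\<^sub>1 u v) \<longlongrightarrow> 0) (at l\<^sub>0 within Lambda)" (is "(?F \<longlongrightarrow> 0) _")
      and x: "x \<in> Lp p" for l\<^sub>0 x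
  proof -
    let ?N = "enn2real (Lp_norm p x)"
    have "?G l \<le> ennreal (\<bar>?F l\<bar> * ?N)" if "l \<in> Lambda" for l
      using that Lp_norm_commutator_le[OF p x] by (auto split: prod.splits)
    then have le: "eventually (\<lambda>l. ?G l \<le> ennreal (\<bar>?F l\<bar> * ?N)) (at l\<^sub>0 within Lambda)"
      unfolding eventually_at_filter by (intro always_eventually allI impI)
    have "((\<lambda>l. ennreal (\<bar>?F l\<bar> * ?N)) \<longlongrightarrow> ennreal (\<bar>0\<bar> * ?N)) (at l\<^sub>0 within Lambda)"
      by (intro tendsto_ennrealI tendsto_intros lim)
    then have lim0: "((\<lambda>l. ennreal (\<bar>?F l\<bar> * ?N)) \<longlongrightarrow> 0) (at l\<^sub>0 within Lambda)"
      by simp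
    show ?thesis
      by (rule tendsto_sandwich[OF _ le tendsto_const lim0]) simp
  qed
  show ?thesis
    unfolding A' B' ops
    by (intro conjI impI ballI allI;
        (rule cov commute formula[unfolded ops] 4[unfolded ops] 5
           2[unfolded A' ops, THEN conjunct1] 2[unfolded A' ops, THEN conjunct2]
           3[unfolded B' ops, THEN conjunct1] 3[unfolded B' ops, THEN conjunct2]; assumption))
qed

end
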